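(* Let $n\ge 1$ and let $A$ be an $n\times n$ Markov matrix. Then $S3_n$ is an invariant subspace of $A$; that is, $S3_n$ is a linear subspace of $\mathbb{R}^n$ and $AX\in S3_n$ for every $X\in S3_n$.
   Context: A real $n\times n$ matrix $A=(a_{ij})$ is called a Markov matrix if $a_{ij}\ge 0$ for all $1\le i,j\le n$ and $\sum_{i=1}^n a_{ij}=1$ for every $1\le j\le n$ (each column sums to $1$). It acts on column vectors by $X\mapsto AX$. Notation: $S3_n=\{X=(x_1,\dots,x_n)^T\in\mathbb{R}^n : \sum_{i=1}^n x_i=0\}$. *)

theory Defs
  imports "HOL-Analysis.Analysis"
begin

(* Column-stochastic convention: A $ i $ j is the entry in row i, column j. *)
definition markov_matrix :: "real ^ 'n ^ 'n \<Rightarrow> bool" where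
  "markov_matrix A \<longleftrightarrow>
     (\<forall>i j. A $ i $ j \<ge> 0) \<and> (\<forall>j. (\<Sum>i\<in>UNIV. A $ i $ j) = 1)"

definition S3 :: "(real ^ 'n) set" where
  "S3 = {X. (\<Sum>i\<in>UNIV. X $ i) = 0}"

definition invariant_subspace :: "real ^ 'n ^ 'n \<Rightarrow> (real ^ 'n) set \<Rightarrow> bool" where
  "invariant_subspace A S \<longleftrightarrow> subspace S \<and> (\<forall>X\<in>S. A *v X \<in> S)"

end

theory Submission
  imports Defs
begin

text \<open>\<open>S3\<close> is the kernel of the coordinate-sum functional, hence a subspace. Unit
  column sums make \<open>A\<close> preserve this functional
  (\<open>markov_matrix_sum_mult_vec\<close>), so \<open>A\<close> maps its kernel into
  itself.\<close>

lemma subspace_S3: "subspace (S3 :: (real ^ 'n) set)"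
  by (simp add: subspace_def S3_def sum.distrib flip: sum_distrib_left)

text \<open>Unit column sums say that the all-ones row vector is a left eigenvector of
  \<open>A\<close> for eigenvalue 1; pair it with \<open>X\<close>.\<close>

lemma markov_matrix_sum_mult_vec:
  fixes A :: "real ^ 'n ^ 'n"
  assumes "markov_matrix A"
  shows "(\<Sum>i\<in>UNIV. (A *v X) $ i) = (\<Sum>j\<in>UNIV. X $ j)"
proof -
  have "(\<Sum>i\<in>UNIV. (A *v X) $ i) = (\<Sum>i\<in>UNIV. \<Sum>j\<in>UNIV. A $ i $ j * X $ j)"
    by (simp add: matrix_vector_mult_def)
  \<comment> \<open>Summing over rows first isolates the column sums.\<close>
  also have "\<dots> = (\<Sum>j\<in>UNIV. \<Sum>i\<in>UNIV. A $ i $ j * X $ j)"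
    by (rule sum.swap)
  also have "\<dots> = (\<Sum>j\<in>UNIV. (\<Sum>i\<in>UNIV. A $ i $ j) * X $ j)"
    by (simp add: sum_distrib_right)
  also have "\<dots> = (\<Sum>j\<in>UNIV. X $ j)"
    using assms by (simp add: markov_matrix_def)
  finally show ?thesis .
qed

theorem theorem5:
  fixes A :: "real ^ 'n ^ 'n"
  assumes "markov_matrix A"
  shows "invariant_subspace A S3"
  using markov_matrix_sum_mult_vec[OF assms] subspace_S3
  by (simp add: invariant_subspace_def S3_def)

end
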